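(* Let $G$ be a discrete group, $T$ a syndetic subgroup of $G$, and $\xi\in L^\infty(G)$. Then $\xi$ is $T$-a.p. in the sense of Bochner--von Neumann if and only if every element of $H_T(\xi)$ is a $T$-a.a. function on $G$.
   Context: $L^\infty(G)$ is the set of bounded real-valued functions on $G$ (with no measure-theoretic identification). For $t\in G$, $f\in L^\infty(G)$, $tf$ is defined by $(tf)(x)=f(xt)$, $x\in G$. The pointwise topology on $L^\infty(G)$ is that of pointwise convergence on $G$; $\|\cdot\|$ is the supremum norm. $H_T(\xi)$ is the closure of $\{t\xi: t\in T\}$ in the pointwise topology. A subset $T\subseteq G$ of the discrete group $G$ is syndetic if there is a finite $K\subseteq G$ with $Kg\cap T\neq\emptyset$ for all $g\in G$. $f\in L^\infty(G)$ is (right) $T$-a.p. in the sense of Bochner--von Neumann if $Tf=\{tf:t\in T\}$ is relatively compact in $(L^\infty(G),\|\cdot\|)$. $f\in L^\infty(G)$ is a (right) $T$-a.a. function on $G$ if for every net $\{t_n\}$ in $T$ and net $\{f_n'\}$ in $L^\infty(G)$, with all limits in the pointwise topology on $L^\infty(G)$: $t_nf\to\eta$, $f_n'\to f'$ and $t_nf_n'=\eta$ for all $n$ imply $f=f'$. *)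

theory Defs
  imports "HOL-Analysis.Analysis" "HOL-Algebra.Coset"
begin

text \<open>
  \<open>L\<^sup>\<infinity>(G)\<close>, as a metric space: bounded real functions on \<open>carrier G\<close> (made extensional, i.e.
  \<open>undefined\<close> off the carrier, so that equality is equality on \<open>G\<close>), with the distance
  \<open>Sup {\<bar>f x - g x\<bar> | x. x \<in> carrier G}\<close> coming from the supremum norm.
\<close>

definition Linf_metric :: "('a, 'b) monoid_scheme \<Rightarrow> ('a \<Rightarrow> real) metric" where
  "Linf_metric G = funspace (carrier G) euclidean_metric"

definition Linf :: "('a, 'b) monoid_scheme \<Rightarrow> ('a \<Rightarrow> real) set" where
  "Linf G = mspace (Linf_metric G)"

lemma Linf_iff:
  "f \<in> Linf G \<longleftrightarrow> f \<in> extensional (carrier G) \<and> (\<exists>B. \<forall>x\<in>carrier G. \<bar>f x\<bar> \<le> B)"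
  by (simp add: Linf_def Linf_metric_def Met_TC.fspace_def bounded_iff)

definition pointwise_topology :: "('a, 'b) monoid_scheme \<Rightarrow> ('a \<Rightarrow> real) topology" where
  "pointwise_topology G =
     subtopology (product_topology (\<lambda>_. euclideanreal) (carrier G)) (Linf G)"

definition translate :: "('a, 'b) monoid_scheme \<Rightarrow> 'a \<Rightarrow> ('a \<Rightarrow> real) \<Rightarrow> 'a \<Rightarrow> real" where
  "translate G t f = (\<lambda>x\<in>carrier G. f (x \<otimes>\<^bsub>G\<^esub> t))"

definition orbit_hull ::
    "('a, 'b) monoid_scheme \<Rightarrow> 'a set \<Rightarrow> ('a \<Rightarrow> real) \<Rightarrow> ('a \<Rightarrow> real) set" where
  "orbit_hull G T f = Abstract_Topology.closure_of (pointwise_topology G) ((\<lambda>t. translate G t f) ` T)"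

definition syndetic :: "('a, 'b) monoid_scheme \<Rightarrow> 'a set \<Rightarrow> bool" where
  "syndetic G T \<longleftrightarrow> T \<subseteq> carrier G \<and>
     (\<exists>K. finite K \<and> K \<subseteq> carrier G \<and> (\<forall>g\<in>carrier G. (K #>\<^bsub>G\<^esub> g) \<inter> T \<noteq> {}))"

definition bochner_ap :: "('a, 'b) monoid_scheme \<Rightarrow> 'a set \<Rightarrow> ('a \<Rightarrow> real) \<Rightarrow> bool" where
  "bochner_ap G T f \<longleftrightarrow> f \<in> Linf G \<and>
     compactin (mtopology_of (Linf_metric G))
       (Abstract_Topology.closure_of (mtopology_of (Linf_metric G)) ((\<lambda>t. translate G t f) ` T))"

definition directed_set :: "'i set \<Rightarrow> ('i \<Rightarrow> 'i \<Rightarrow> bool) \<Rightarrow> bool" where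
  "directed_set I r \<longleftrightarrow> I \<noteq> {} \<and> (\<forall>i\<in>I. r i i) \<and>
     (\<forall>i\<in>I. \<forall>j\<in>I. \<forall>k\<in>I. r i j \<longrightarrow> r j k \<longrightarrow> r i k) \<and>
     (\<forall>i\<in>I. \<forall>j\<in>I. \<exists>k\<in>I. r i k \<and> r j k)"

lemma directed_set_trans:
  assumes "directed_set I r" "i \<in> I" "j \<in> I" "k \<in> I" "r i j" "r j k"
  shows "r i k"
proof -
  have "\<forall>i\<in>I. \<forall>j\<in>I. \<forall>k\<in>I. r i j \<longrightarrow> r j k \<longrightarrow> r i k"
    using assms(1) unfolding directed_set_def by (elim conjE)
  from this[rule_format, OF assms(2-6)] show ?thesis .
qed

lemma directed_set_bound:
  assumes "directed_set I r" "i \<in> I" "j \<in> I"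
  obtains k where "k \<in> I" "r i k" "r j k"
proof -
  have "\<forall>i\<in>I. \<forall>j\<in>I. \<exists>k\<in>I. r i k \<and> r j k"
    using assms(1) unfolding directed_set_def by (elim conjE)
  from this[rule_format, OF assms(2,3)] show ?thesis
    using that by auto
qed

text \<open>The filter of tails: convergence of a net indexed by \<open>(I, r)\<close> is \<open>limitin\<close> along it.\<close>

definition tails :: "'i set \<Rightarrow> ('i \<Rightarrow> 'i \<Rightarrow> bool) \<Rightarrow> 'i filter" where
  "tails I r = (INF i\<in>I. principal {j\<in>I. r i j})"

lemma eventually_tails:
  assumes "directed_set I r"
  shows "eventually P (tails I r) \<longleftrightarrow> (\<exists>i\<in>I. \<forall>j\<in>I. r i j \<longrightarrow> P j)"
proof -
  have ne: "I \<noteq> {}"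
    using assms by (simp add: directed_set_def)
  have dir: "\<exists>k\<in>I. principal {n\<in>I. r k n} \<le> inf (principal {n\<in>I. r i n}) (principal {n\<in>I. r j n})"
    if ij: "i \<in> I" "j \<in> I" for i j
  proof -
    obtain k where k: "k \<in> I" "r i k" "r j k"
      using directed_set_bound[OF assms ij] by blast
    have "{n\<in>I. r k n} \<subseteq> {n\<in>I. r i n} \<inter> {n\<in>I. r j n}"
    proof
      fix n assume "n \<in> {n\<in>I. r k n}"
      then have n: "n \<in> I" "r k n"
        by simp_all
      show "n \<in> {n\<in>I. r i n} \<inter> {n\<in>I. r j n}"
        using n directed_set_trans[OF assms ij(1) k(1) n(1) k(2) n(2)]
          directed_set_trans[OF assms ij(2) k(1) n(1) k(3) n(2)] by simp
    qed
    then show ?thesis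
      by (intro bexI[OF _ k(1)]) (simp only: inf_principal principal_le_iff)
  qed
  have "eventually P (tails I r) \<longleftrightarrow> (\<exists>i\<in>I. eventually P (principal {n\<in>I. r i n}))"
    unfolding tails_def by (rule eventually_INF_base[OF ne dir])
  then show ?thesis
    by (simp add: eventually_principal imp_conjL Ball_def)
qed

text \<open>
  HOL cannot quantify over the index types of nets inside a definition, so the definition below
  fixes one type of indices.  It is large enough: every net of pairs \<open>(t n, f' n)\<close> over an
  arbitrary index type can be re-indexed by pairs of a member and a tail of its values.  The lemma
  \<open>T_aa_net\<close> shows that the defining property then holds for nets over every index type.
\<close>

type_synonym 'a net_index = "('a \<times> ('a \<Rightarrow> real)) \<times> ('a \<times> ('a \<Rightarrow> real)) set"

definition T_aa :: "('a, 'b) monoid_scheme \<Rightarrow> 'a set \<Rightarrow> ('a \<Rightarrow> real) \<Rightarrow> bool" where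
  "T_aa G T f \<longleftrightarrow> f \<in> Linf G \<and>
     (\<forall>(I :: 'a net_index set) r t f' \<eta> g.
        directed_set I r \<longrightarrow>
        (\<forall>n\<in>I. t n \<in> T) \<longrightarrow>
        (\<forall>n\<in>I. f' n \<in> Linf G) \<longrightarrow>
        limitin (pointwise_topology G) (\<lambda>n. translate G (t n) f) \<eta> (tails I r) \<longrightarrow>
        limitin (pointwise_topology G) f' g (tails I r) \<longrightarrow>
        (\<forall>n\<in>I. translate G (t n) (f' n) = \<eta>) \<longrightarrow>
        f = g)"

lemma T_aa_net:
  fixes I :: "'i set"
  assumes aa: "T_aa G T f" and dir: "directed_set I r"
    and t: "\<And>n. n \<in> I \<Longrightarrow> t n \<in> T" and f': "\<And>n. n \<in> I \<Longrightarrow> f' n \<in> Linf G"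
    and lim1: "limitin (pointwise_topology G) (\<lambda>n. translate G (t n) f) \<eta> (tails I r)"
    and lim2: "limitin (pointwise_topology G) f' g (tails I r)"
    and eq: "\<And>n. n \<in> I \<Longrightarrow> translate G (t n) (f' n) = \<eta>"
  shows "f = g"
proof -
  define p where "p n = (t n, f' n)" for n
  define tl where "tl i = p ` {j\<in>I. r i j}" for i
  define J where "J = {(x, S). \<exists>i\<in>I. S = tl i \<and> x \<in> S}"
  define r' :: "'a net_index \<Rightarrow> 'a net_index \<Rightarrow> bool" where "r' a b \<longleftrightarrow> snd b \<subseteq> snd a" for a b
  have refl: "r i i" if "i \<in> I" for i
  proof -
    have "\<forall>i\<in>I. r i i"
      using dir unfolding directed_set_def by (elim conjE)
    then show ?thesis using that by (rule bspec)
  qed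
  have JI: "(p j, tl i) \<in> J" if "i \<in> I" "j \<in> I" "r i j" for i j
    unfolding J_def tl_def using that by blast
  have JD: "\<exists>i\<in>I. \<exists>j\<in>I. r i j \<and> a = (p j, tl i)" if "a \<in> J" for a
    using that by (cases a) (auto simp: J_def tl_def)
  have tl_mono: "tl k \<subseteq> tl i" if "i \<in> I" "k \<in> I" "r i k" for i k
  proof
    fix x assume "x \<in> tl k"
    then obtain j where j: "j \<in> I" "r k j" "x = p j"
      unfolding tl_def by blast
    have "r i j"
      by (rule directed_set_trans[OF dir that(1,2) j(1) that(3) j(2)])
    with j show "x \<in> tl i"
      unfolding tl_def by blast
  qed
  have dirJ: "directed_set J r'"
    unfolding directed_set_def
  proof (intro conjI)
    have "I \<noteq> {}"
      using dir unfolding directed_set_def by (elim conjE)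
    then obtain i where i: "i \<in> I"
      by blast
    show "J \<noteq> {}"
      using JI[OF i i refl[OF i]] by blast
    show "\<forall>a\<in>J. r' a a"
      by (simp add: r'_def)
    show "\<forall>a\<in>J. \<forall>b\<in>J. \<forall>c\<in>J. r' a b \<longrightarrow> r' b c \<longrightarrow> r' a c"
      unfolding r'_def by (intro ballI impI) (rule subset_trans)
    show "\<forall>a\<in>J. \<forall>b\<in>J. \<exists>c\<in>J. r' a c \<and> r' b c"
    proof (intro ballI)
      fix a b assume ab: "a \<in> J" "b \<in> J"
      obtain i where i: "i \<in> I" "snd a = tl i"
        using JD[OF ab(1)] by fastforce
      obtain j where j: "j \<in> I" "snd b = tl j"
        using JD[OF ab(2)] by fastforce
      obtain k where k: "k \<in> I" "r i k" "r j k"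
        using directed_set_bound[OF dir i(1) j(1)] .
      have "r' a (p k, tl k)" "r' b (p k, tl k)"
        unfolding r'_def snd_conv i(2) j(2) using tl_mono i(1) j(1) k by simp_all
      with JI[OF k(1) k(1) refl[OF k(1)]] show "\<exists>c\<in>J. r' a c \<and> r' b c"
        by (intro bexI conjI)
    qed
  qed
  have ev: "eventually (\<lambda>a. Q (fst a)) (tails J r')"
    if ev: "eventually (\<lambda>n. Q (p n)) (tails I r)" for Q
  proof -
    obtain i where i: "i \<in> I" "\<forall>j\<in>I. r i j \<longrightarrow> Q (p j)"
      using ev unfolding eventually_tails[OF dir] ..
    have "Q (fst a)" if a: "a \<in> J" "r' (p i, tl i) a" for a
    proof -
      obtain k j where kj: "k \<in> I" "j \<in> I" "r k j" "a = (p j, tl k)"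
        using JD[OF a(1)] by blast
      then have "p j \<in> tl k"
        unfolding tl_def by blast
      then have "p j \<in> tl i"
        using a(2) kj(4) by (auto simp: r'_def)
      then obtain j' where "j' \<in> I" "r i j'" "p j = p j'"
        unfolding tl_def by blast
      then show ?thesis
        using i(2) kj(4) by simp
    qed
    then have "\<forall>a\<in>J. r' (p i, tl i) a \<longrightarrow> Q (fst a)"
      by (intro ballI impI)
    then show ?thesis
      unfolding eventually_tails[OF dirJ] by (rule bexI) (rule JI[OF i(1) i(1) refl[OF i(1)]])
  qed
  have tr: "limitin X (\<lambda>a. h (fst a)) l (tails J r')"
    if "limitin X (\<lambda>n. h (p n)) l (tails I r)" for X :: "('a \<Rightarrow> real) topology" and h l
    unfolding limitin_def
  proof (intro conjI allI impI)
    show "l \<in> topspace X"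
      using that by (simp add: limitin_def)
    fix U assume "openin X U \<and> l \<in> U"
    then have "eventually (\<lambda>n. h (p n) \<in> U) (tails I r)"
      using that by (simp add: limitin_def)
    then show "eventually (\<lambda>a. h (fst a) \<in> U) (tails J r')"
      by (rule ev)
  qed
  have fstJ: "\<exists>n\<in>I. fst a = (t n, f' n)" if "a \<in> J" for a
    using JD[OF that] by (auto simp: p_def)
  have 1: "\<forall>a\<in>J. fst (fst a) \<in> T" "\<forall>a\<in>J. snd (fst a) \<in> Linf G"
       "\<forall>a\<in>J. translate G (fst (fst a)) (snd (fst a)) = \<eta>"
    using fstJ t f' eq by (metis fst_conv snd_conv)+
  have 2: "limitin (pointwise_topology G) (\<lambda>a. translate G (fst (fst a)) f) \<eta> (tails J r')"
    using tr[of "pointwise_topology G" "\<lambda>x. translate G (fst x) f" \<eta>] lim1 by (simp add: p_def)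
  have 3: "limitin (pointwise_topology G) (\<lambda>a. snd (fst a)) g (tails J r')"
    using tr[of "pointwise_topology G" snd g] lim2 by (simp add: p_def)
  show ?thesis
    by (rule aa[unfolded T_aa_def, THEN conjunct2, rule_format, OF dirJ _ _ 2 3])
      (simp_all only: 1[rule_format])
qed

end

(* The heart is the implication from almost automorphy to precompactness. Relative compactness in
   norm only involves sequences in the orbit, so T may be replaced by a countable subgroup, and then
   the hull is a compact metrizable flow on which  t_n x --> y  and  t_n^{-1} y --> z  force x = z.
   Such a flow is minimal. Two applications of Baire's theorem make this recurrence uniform: first
   the pairs (x, w) are distal with a bound depending only on x and the distance of x and w, then the
   bound becomes uniform for x in a ball. If the flow were not equicontinuous, there would be pairs
   u_n, v_n at distance tending to 0 whose translates converge to distinct points x and w; moving x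
   into the ball contradicts the uniform bound. Equicontinuity turns pointwise convergent sequences
   in the orbit into uniformly convergent ones, finitely many cosets of T covering G. *)

theory Submission
  imports Defs "HOL-Algebra.Generated_Groups"
begin

section \<open>Compact almost automorphic flows are equicontinuous\<close>

lemma tendsto_of_dist_tendsto_0:
  fixes f g :: "'b \<Rightarrow> 'x::metric_space"
  assumes "(f \<longlongrightarrow> l) F" "((\<lambda>n. dist (f n) (g n)) \<longlongrightarrow> 0) F"
  shows "(g \<longlongrightarrow> l) F"
proof -
  have "((\<lambda>n. dist (f n) (g n) + dist (f n) l) \<longlongrightarrow> 0 + 0) F"
    using assms by (intro tendsto_add) (simp_all flip: tendsto_dist_iff)
  then have "((\<lambda>n. dist (g n) l) \<longlongrightarrow> 0) F"
    by (intro Lim_null_comparison[of "\<lambda>n. dist (g n) l"]) (auto simp: dist_triangle3)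
  then show ?thesis
    by (simp flip: tendsto_dist_iff)
qed

text \<open>The subspace \<open>X\<close> is locally compact and regular, so Baire's theorem holds
  in it: countably many relatively closed sets with empty relative interior cannot cover it. A
  nonempty relative interior contains the trace of a ball.\<close>

lemma compact_Baire_ball:
  fixes X :: "'x::metric_space set" and A :: "nat \<Rightarrow> 'x set"
  assumes "compact X" "X \<noteq> {}" and closed: "\<And>m. closedin (top_of_set X) (A m)"
    and cover: "X \<subseteq> (\<Union>m. A m)"
  obtains m z r where "z \<in> X" "r > 0" "X \<inter> ball z r \<subseteq> A m"
proof -
  have "\<exists>m. top_of_set X interior_of A m \<noteq> {}"
  proof (rule ccontr)
    assume "\<not> ?thesis"
    moreover have "locally_compact_space (top_of_set X)" "regular_space (top_of_set X)"
      using \<open>compact X\<close> by (simp_all add: compact_imp_locally_compact_space compact_space_subtopology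
        regular_space_subtopology regular_space_euclidean)
    ultimately have "top_of_set X interior_of \<Union>(range A) = {}"
      using closed by (intro Baire_category_alt) blast+
    moreover have "\<Union>(range A) = X"
      using cover closedin_imp_subset[OF closed] by blast
    ultimately show False
      using \<open>X \<noteq> {}\<close> interior_of_topspace[of "top_of_set X"] by (metis topspace_euclidean_subtopology)
  qed
  then obtain m z where z: "z \<in> top_of_set X interior_of A m"
    by blast
  then obtain U where "openin (top_of_set X) U" "z \<in> U" "U \<subseteq> A m"
    by (auto simp: interior_of_def)
  then obtain r where "r > 0" "ball z r \<inter> X \<subseteq> U" "z \<in> X"
    unfolding openin_contains_ball by blast
  then show thesis
    using \<open>U \<subseteq> A m\<close> by (intro that[of z r m]) blast+
qed

text \<open>The flow laws are required only for group elements in \<open>T\<close> and points in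
  \<open>X\<close>, since the shift used later is an action only there. Sequences suffice in
  \<open>aa\<close> because \<open>X\<close> is metric; \<open>aa\<close> concerns every point of
  \<open>X\<close>, not only \<open>x0\<close>, matching the hypothesis on the whole hull.\<close>

locale compact_aa_flow = group G for G (structure) +
  fixes T :: "'a set" and act :: "'a \<Rightarrow> 'x::metric_space \<Rightarrow> 'x" and X :: "'x set" and x0 :: 'x
  assumes subgroup_T: "subgroup T G"
    and compact_X: "compact X" and x0: "x0 \<in> X"
    and act_closed: "\<And>t x. t \<in> T \<Longrightarrow> x \<in> X \<Longrightarrow> act t x \<in> X"
    and act_cont: "\<And>t. t \<in> T \<Longrightarrow> continuous_on X (act t)"
    and act_mult: "\<And>s t x. s \<in> T \<Longrightarrow> t \<in> T \<Longrightarrow> x \<in> X \<Longrightarrow> act (s \<otimes> t) x = act s (act t x)"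
    and act_one: "\<And>x. x \<in> X \<Longrightarrow> act \<one> x = x"
    and dense_orbit: "X \<subseteq> closure ((\<lambda>t. act t x0) ` T)"
    and aa: "\<And>t x y z. \<lbrakk>\<And>n::nat. t n \<in> T; x \<in> X; y \<in> X; z \<in> X;
        (\<lambda>n. act (t n) x) \<longlonglongrightarrow> y; (\<lambda>n. act (inv (t n)) y) \<longlonglongrightarrow> z\<rbrakk> \<Longrightarrow> x = z"
begin

lemma inv_T [simp]: "t \<in> T \<Longrightarrow> inv t \<in> T"
  and mult_T [simp]: "s \<in> T \<Longrightarrow> t \<in> T \<Longrightarrow> s \<otimes> t \<in> T"
  and one_T [simp]: "\<one> \<in> T"
  and T_nonempty [simp]: "T \<noteq> {}"
  and T_carrier [simp]: "t \<in> T \<Longrightarrow> t \<in> carrier G"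
  using subgroup_T by (auto simp: subgroup_def)

lemma act_inv [simp]: "t \<in> T \<Longrightarrow> x \<in> X \<Longrightarrow> act (inv t) (act t x) = x"
  by (simp add: act_mult[symmetric] act_one)

lemma act_tendsto:
  assumes "t \<in> T" "\<And>n. f n \<in> X" "x \<in> X" "f \<longlonglongrightarrow> x"
  shows "(\<lambda>n. act t (f n)) \<longlonglongrightarrow> act t x"
  using assms by (intro continuous_on_tendsto_compose[OF act_cont]) simp_all

lemma closedin_dist_le:
  fixes f g h k :: "'x \<Rightarrow> 'x"
  assumes "continuous_on X f" "continuous_on X g" "continuous_on X h" "continuous_on X k"
  shows "closedin (top_of_set X) {y \<in> X. dist (f y) (g y) < d \<longrightarrow> dist (h y) (k y) \<le> e}"
proof -
  have "{y \<in> X. dist (f y) (g y) < d \<longrightarrow> dist (h y) (k y) \<le> e} =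
     (X \<inter> (\<lambda>y. dist (f y) (g y)) -` {d..}) \<union> (X \<inter> (\<lambda>y. dist (h y) (k y)) -` {..e})"
    by auto
  then show ?thesis
    using assms by (auto intro!: closedin_Un continuous_closedin_preimage continuous_on_dist)
qed

text \<open>A failure at every m gives \<open>t m\<close> with \<open>act (t m) x\<close> tending to
  y, while \<open>act (inv (t m)) y\<close> stays more than e away from x; a cluster point of the
  latter contradicts \<open>aa\<close>. Thresholds run through a countable family and the conclusion
  is non-strict, so that the sets of admissible points are closed and Baire's theorem can be
  used.\<close>

lemma recurrence:
  assumes "x \<in> X" "y \<in> X" "e > 0"
  shows "\<exists>m::nat. \<forall>t\<in>T. dist (act t x) y < inverse (Suc m) \<longrightarrow> dist (act (inv t) y) x \<le> e"
proof (rule ccontr)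
  assume "\<not> ?thesis"
  then have "\<forall>m::nat. \<exists>t. t \<in> T \<and> dist (act t x) y < inverse (Suc m) \<and> dist (act (inv t) y) x > e"
    unfolding not_ex not_all ball_simps Bex_def by (auto simp only: not_le not_imp)
  from choice[OF this] obtain t where t: "\<And>m. t m \<in> T" "\<And>m. dist (act (t m) x) y < inverse (Suc m)"
    "\<And>m. dist (act (inv (t m)) y) x > e"
    by blast
  have "\<forall>n. act (inv (t n)) y \<in> X"
    using t assms by (simp add: act_closed)
  then obtain z r where z: "z \<in> X" "strict_mono r" "((\<lambda>n. act (inv (t n)) y) \<circ> r) \<longlonglongrightarrow> z"
    by (rule seq_compactE[OF compact_imp_seq_compact[OF compact_X]])
  have "(\<lambda>n. dist (act (t n) x) y) \<longlonglongrightarrow> 0"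
    by (rule Lim_null_comparison[OF _ LIMSEQ_inverse_real_of_nat])
      (use t(2) in \<open>simp add: less_imp_le del: of_nat_Suc\<close>)
  then have "(\<lambda>n. act (t (r n)) x) \<longlonglongrightarrow> y"
    using LIMSEQ_subseq_LIMSEQ[OF _ z(2), of "\<lambda>n. act (t n) x"] by (simp add: tendsto_dist_iff[symmetric] o_def)
  then have "x = z"
    using z assms t(1) by (intro aa[of "\<lambda>n. t (r n)" x y z]) (simp_all only: o_def)
  moreover have "dist z x \<ge> e"
    using t(3) by (intro tendsto_lowerbound[OF tendsto_dist[OF z(3) tendsto_const]])
      (auto simp: less_imp_le)
  ultimately show False
    using \<open>e > 0\<close> by simp
qed

text \<open>Recurrence at \<open>x0\<close> reverses density: if t carries \<open>x0\<close> close
  to x, then \<open>inv t\<close> carries x close to \<open>x0\<close>. A further element s with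
  \<open>act s x0\<close> near y finishes the journey.\<close>

lemma minimal:
  assumes "x \<in> X" "y \<in> X" "e > 0"
  obtains t where "t \<in> T" "dist (act t x) y < e"
proof -
  have approx: "\<exists>t\<in>T. dist (act t x0) z < d" if "z \<in> X" "d > 0" for z d
    using subsetD[OF dense_orbit that(1)] that(2) by (auto simp: closure_approachable)
  obtain s where s: "s \<in> T" "dist (act s x0) y < e/2"
    using approx[of y "e/2"] assms(2,3) half_gt_zero by blast
  obtain d where d: "d > 0" "\<And>z. z \<in> X \<Longrightarrow> dist z x0 < d \<Longrightarrow> dist (act s z) (act s x0) < e/2"
    using act_cont[OF s(1)] x0 half_gt_zero[OF \<open>e > 0\<close>] unfolding continuous_on_iff by blast
  obtain m :: nat where m: "\<forall>t\<in>T. dist (act t x0) x < inverse (Suc m) \<longrightarrow> dist (act (inv t) x) x0 \<le> d/2"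
    using recurrence[OF x0 assms(1) half_gt_zero[OF d(1)]] by blast
  obtain t where t: "t \<in> T" "dist (act t x0) x < inverse (Suc m)"
    using approx[OF assms(1), of "inverse (Suc m)"] by (auto simp del: of_nat_Suc)
  have "dist (act s (act (inv t) x)) (act s x0) < e/2"
    using m[rule_format, OF t] d(1) assms(1) t(1) by (intro d(2)) (auto simp: act_closed)
  then have "dist (act (s \<otimes> inv t) x) y < e"
    using s(2) dist_triangle[of "act s (act (inv t) x)" y "act s x0"] s(1) t(1) assms(1)
    by (simp add: act_mult dist_commute)
  then show thesis
    by (rule that[rotated]) (use s t in simp)
qed

section \<open>Uniform distality by Baire category\<close>

lemma Baire_parameter:
  assumes "\<And>m::nat. closedin (top_of_set X) {y\<in>X. P (inverse (Suc m)) y}"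
    and "\<And>y. y \<in> X \<Longrightarrow> \<exists>m::nat. P (inverse (Suc m)) y"
  obtains m::nat and z r where "z \<in> X" "r > 0" "\<And>y. y \<in> X \<Longrightarrow> dist y z < r \<Longrightarrow> P (inverse (Suc m)) y"
proof -
  have cover: "X \<subseteq> (\<Union>m. {y\<in>X. P (inverse (Suc m)) y})"
    using assms(2) by blast
  have "X \<noteq> {}"
    using x0 by blast
  obtain m z r where
    "z \<in> X" "r > 0" "X \<inter> ball z r \<subseteq> {y\<in>X. P (inverse (Suc m)) y}"
    by (rule compact_Baire_ball[OF compact_X \<open>X \<noteq> {}\<close> assms(1) cover]) (rule that)
  then show thesis
    by (intro that[of z r m]) (auto simp: dist_commute simp del: of_nat_Suc)
qed

text \<open>Baire's theorem in the target point y makes the threshold of \<open>recurrence\<close>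
  constant on a ball. If translates of x and of points \<open>w n\<close> approach each other,
  minimality moves both into that ball by one element g; recurrence with target
  \<open>act g (w n)\<close> then bounds the distance of \<open>w n\<close> from x.\<close>

lemma distal:
  assumes "x \<in> X" "e > 0"
  shows "\<exists>m::nat. \<forall>t\<in>T. \<forall>w\<in>X. dist (act t x) (act t w) < inverse (Suc m) \<longrightarrow> dist w x \<le> e"
proof (rule ccontr)
  assume contra: "\<not> ?thesis"
  let ?P = "\<lambda>d y. \<forall>t\<in>T. dist (act t x) y < d \<longrightarrow> dist (act (inv t) y) x \<le> e"
  have "closedin (top_of_set X) {y\<in>X. ?P d y}" for d
  proof -
    have "{y\<in>X. ?P d y} = (\<Inter>t\<in>T. {y\<in>X. dist (act t x) y < d \<longrightarrow> dist (act (inv t) y) x \<le> e})"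
      using one_T by blast
    also have "closedin (top_of_set X) \<dots>"
      using one_T by (intro closedin_INT closedin_dist_le) (auto intro!: continuous_intros act_cont)
    finally show ?thesis .
  qed
  then obtain m z r where m: "z \<in> X" "r > 0" "\<And>y. y \<in> X \<Longrightarrow> dist y z < r \<Longrightarrow> ?P (inverse (Suc m)) y"
    by (rule Baire_parameter[of ?P]) (use recurrence[OF assms(1) _ assms(2)] in blast)+
  \<comment> \<open>Two points within q of z lie in the ball of radius r and are less than
    \<open>inverse (Suc m)\<close> apart.\<close>
  define q where "q = min r (inverse (Suc m) / 2)"
  have q: "q > 0" "q \<le> r" "2 * q \<le> inverse (Suc m)"
    using m(2) by (auto simp: q_def min_def)
  have "\<forall>n::nat. \<exists>t\<in>T. \<exists>w\<in>X. dist (act t x) (act t w) < inverse (Suc n) \<and> dist w x > e"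
    using contra by (simp only: not_ex not_le not_imp ball_simps bex_simps) blast
  then obtain t w where tw: "\<And>n. t n \<in> T" "\<And>n. w n \<in> X"
    "\<And>n. dist (act (t n) x) (act (t n) (w n)) < inverse (Suc n)" "\<And>n. dist (w n) x > e"
    by metis
  have "\<forall>n. act (t n) x \<in> X"
    using tw assms by (simp add: act_closed)
  then obtain y \<rho> where y: "y \<in> X" "strict_mono \<rho>" "((\<lambda>n. act (t n) x) \<circ> \<rho>) \<longlonglongrightarrow> y"
    by (rule seq_compactE[OF compact_imp_seq_compact[OF compact_X]])
  obtain s where s: "s \<in> T" "dist (act s y) z < q"
    using minimal[OF y(1) m(1) q(1)] .
  have "(\<lambda>n. dist (act (t n) x) (act (t n) (w n))) \<longlonglongrightarrow> 0"
    by (rule Lim_null_comparison[OF _ LIMSEQ_inverse_real_of_nat])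
      (use tw(3) in \<open>simp add: less_imp_le del: of_nat_Suc\<close>)
  from LIMSEQ_subseq_LIMSEQ[OF this y(2)]
  have "(\<lambda>n. act (t (\<rho> n)) (w (\<rho> n))) \<longlonglongrightarrow> y"
    using y(3) by (auto simp: o_def intro: tendsto_of_dist_tendsto_0)
  then have lim: "(\<lambda>n. act s (act (t (\<rho> n)) (w (\<rho> n)))) \<longlonglongrightarrow> act s y"
    "(\<lambda>n. act s (act (t (\<rho> n)) x)) \<longlonglongrightarrow> act s y"
    using s y tw assms by (auto intro!: act_tendsto simp: act_closed o_def)
  have "\<forall>\<^sub>F n in sequentially. dist (act s (act (t (\<rho> n)) (w (\<rho> n)))) z < q
      \<and> dist (act s (act (t (\<rho> n)) x)) z < q"
    using s(2) order_tendstoD(2)[OF tendsto_dist[OF lim(1) tendsto_const]]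
      order_tendstoD(2)[OF tendsto_dist[OF lim(2) tendsto_const]] by (auto intro: eventually_conj)
  then obtain n where n: "dist (act s (act (t (\<rho> n)) (w (\<rho> n)))) z < q"
      "dist (act s (act (t (\<rho> n)) x)) z < q"
    using eventually_happens' sequentially_bot by blast
  let ?g = "s \<otimes> t (\<rho> n)"
  have g: "?g \<in> T" "act ?g x = act s (act (t (\<rho> n)) x)" "act ?g (w (\<rho> n)) = act s (act (t (\<rho> n)) (w (\<rho> n)))"
    using s tw assms by (auto simp: act_mult)
  have "dist (act ?g x) (act ?g (w (\<rho> n))) < inverse (Suc m)"
    using n q unfolding g by (smt (verit) dist_triangle2)
  then have "dist (act (inv ?g) (act ?g (w (\<rho> n)))) x \<le> e"
    using n q g(1) tw by (intro m(3)[rule_format]) (auto simp: g(3)[symmetric] act_closed simp del: act_inv)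
  then have "dist (w (\<rho> n)) x \<le> e"
    using g(1) tw by simp
  then show False
    using tw(4)[of "\<rho> n"] by simp
qed

text \<open>This is the second use of Baire's theorem, now with x as the variable:
  \<open>distal\<close> supplies a threshold for each x, and on some ball a single one
  serves.\<close>

lemma uniformly_distal_on_ball:
  assumes "e > 0"
  obtains m::nat and z r where "z \<in> X" "r > 0"
    "\<And>x t w. \<lbrakk>x \<in> X; dist x z < r; t \<in> T; w \<in> X; dist (act t x) (act t w) < inverse (Suc m)\<rbrakk> \<Longrightarrow> dist w x \<le> e"
proof -
  let ?P = "\<lambda>d x. \<forall>t\<in>T. \<forall>w\<in>X. dist (act t x) (act t w) < d \<longrightarrow> dist w x \<le> e"
  have "closedin (top_of_set X) {y\<in>X. ?P d y}" for d
  proof -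
    have "{y\<in>X. ?P d y} = (\<Inter>(t,w)\<in>T\<times>X. {y\<in>X. dist (act t y) (act t w) < d \<longrightarrow> dist w y \<le> e})"
      using one_T x0 by blast
    also have "closedin (top_of_set X) \<dots>"
      using one_T x0 unfolding split_beta
      by (intro closedin_INT closedin_dist_le) (auto intro!: continuous_intros act_cont)
    finally show ?thesis .
  qed
  then obtain m z r where "z \<in> X" "r > 0" "\<And>y. y \<in> X \<Longrightarrow> dist y z < r \<Longrightarrow> ?P (inverse (Suc m)) y"
    by (rule Baire_parameter[of ?P]) (use distal[OF _ assms] in blast)+
  then show thesis
    by (intro that[of z r m]) auto
qed

text \<open>If close pairs have translates that stay apart, the translated pairs cluster at distinct
  x and w, which \<open>distal\<close> keeps apart under all of \<open>T\<close>. Reading the motion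
  backwards, points near x and w are brought arbitrarily close together, against uniform distality
  once x has been moved into the good ball.\<close>

theorem equicontinuous:
  assumes "e > 0"
  shows "\<exists>d>0. \<forall>t\<in>T. \<forall>u\<in>X. \<forall>v\<in>X. dist u v < d \<longrightarrow> dist (act t u) (act t v) < e"
proof (rule ccontr)
  assume contra: "\<not> ?thesis"
  have "\<exists>t u v. t \<in> T \<and> u \<in> X \<and> v \<in> X \<and> dist u v < inverse (Suc n) \<and> dist (act t u) (act t v) \<ge> e" for n :: nat
  proof -
    have "inverse (real (Suc n)) > 0"
      by simp
    with contra have "\<not> (\<forall>t\<in>T. \<forall>u\<in>X. \<forall>v\<in>X. dist u v < inverse (Suc n) \<longrightarrow> dist (act t u) (act t v) < e)"
      by blast
    then show ?thesis
      by (auto simp: not_less)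
  qed
  then obtain t u v where tuv: "\<And>n. t n \<in> T" "\<And>n. u n \<in> X" "\<And>n. v n \<in> X"
    "\<And>n. dist (u n) (v n) < inverse (Suc n)" "\<And>n. dist (act (t n) (u n)) (act (t n) (v n)) \<ge> e"
    by metis
  have "\<forall>n. (act (t n) (u n), act (t n) (v n)) \<in> X \<times> X"
    using tuv by (simp add: act_closed)
  then obtain p \<rho> where p: "p \<in> X \<times> X" "strict_mono \<rho>"
    "((\<lambda>n. (act (t n) (u n), act (t n) (v n))) \<circ> \<rho>) \<longlonglongrightarrow> p"
    by (rule seq_compactE[OF compact_imp_seq_compact[OF compact_Times[OF compact_X compact_X]]])
  obtain x w where xw: "p = (x, w)" "x \<in> X" "w \<in> X"
    using p(1) by auto
  have lim: "(\<lambda>n. act (t (\<rho> n)) (u (\<rho> n))) \<longlonglongrightarrow> x" "(\<lambda>n. act (t (\<rho> n)) (v (\<rho> n))) \<longlonglongrightarrow> w"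
    using tendsto_fst[OF p(3)] tendsto_snd[OF p(3)] xw by (simp_all add: o_def)
  have "dist x w \<ge> e"
    using tuv(5) by (intro tendsto_lowerbound[OF tendsto_dist[OF lim]]) auto
  \<comment> \<open>The separation c must hold for all translates of x and w at once: the good ball
    is chosen for c/2, and the element s moving x into it depends on that ball.\<close>
  obtain k :: nat where k: "\<forall>t\<in>T. \<forall>w\<in>X. dist (act t x) (act t w) < inverse (Suc k) \<longrightarrow> dist w x \<le> e / 2"
    using distal[OF xw(2), of "e/2"] \<open>e > 0\<close> by auto
  define c where "c = inverse (real (Suc k))"
  have sep: "dist (act s x) (act s w) \<ge> c" if "s \<in> T" for s
    using k[rule_format, OF that xw(3)] \<open>dist x w \<ge> e\<close> \<open>e > 0\<close>
    unfolding c_def dist_commute[of x w] by linarith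
  have "c > 0"
    by (simp add: c_def)
  obtain z r m where m: "z \<in> X" "r > 0"
    "\<And>x t w. \<lbrakk>x \<in> X; dist x z < r; t \<in> T; w \<in> X; dist (act t x) (act t w) < inverse (Suc m)\<rbrakk> \<Longrightarrow> dist w x \<le> c/2"
    by (rule uniformly_distal_on_ball[OF half_gt_zero[OF \<open>c > 0\<close>]]) (rule that)
  obtain s where s: "s \<in> T" "dist (act s x) z < r"
    using minimal[OF xw(2) m(1,2)] .
  have lims: "(\<lambda>n. act s (act (t (\<rho> n)) (u (\<rho> n)))) \<longlonglongrightarrow> act s x"
     "(\<lambda>n. act s (act (t (\<rho> n)) (v (\<rho> n)))) \<longlonglongrightarrow> act s w"
    using s xw lim tuv by (auto intro!: act_tendsto simp: act_closed)
  have "(\<lambda>n. inverse (real (Suc (\<rho> n)))) \<longlonglongrightarrow> 0"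
    using LIMSEQ_subseq_LIMSEQ[OF LIMSEQ_inverse_real_of_nat p(2)] by (simp add: o_def)
  then have "\<forall>\<^sub>F n in sequentially. inverse (real (Suc (\<rho> n))) < inverse (Suc m)"
    by (rule order_tendstoD) simp
  moreover have "\<forall>\<^sub>F n in sequentially. dist (act s (act (t (\<rho> n)) (u (\<rho> n)))) z < r"
    using order_tendstoD(2)[OF tendsto_dist[OF lims(1) tendsto_const] s(2)] .
  moreover have "\<forall>\<^sub>F n in sequentially. dist (act s (act (t (\<rho> n)) (u (\<rho> n)))) (act s (act (t (\<rho> n)) (v (\<rho> n)))) > c/2"
    using sep[OF s(1)] \<open>c > 0\<close> by (intro order_tendstoD(1)[OF tendsto_dist[OF lims]]) simp
  ultimately have "\<forall>\<^sub>F n in sequentially. False"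
  proof eventually_elim
    case (elim n)
    let ?g = "s \<otimes> t (\<rho> n)"
    have g: "?g \<in> T" "act ?g (u (\<rho> n)) = act s (act (t (\<rho> n)) (u (\<rho> n)))"
      "act ?g (v (\<rho> n)) = act s (act (t (\<rho> n)) (v (\<rho> n)))"
      using s tuv by (auto simp: act_mult)
    have gX: "act ?g (u (\<rho> n)) \<in> X" "act ?g (v (\<rho> n)) \<in> X"
      using g(1) tuv by (auto simp only: act_closed)
    have near: "dist (act ?g (u (\<rho> n))) z < r"
      using elim(2) by (simp only: g)
    \<comment> \<open>Applying \<open>inv ?g\<close> returns the original close pair, so uniform
      distality forces the two points in front of it to be within c/2 of each other.\<close>
    have "dist (act (inv ?g) (act ?g (u (\<rho> n)))) (act (inv ?g) (act ?g (v (\<rho> n)))) < inverse (Suc m)"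
      using g(1) tuv(2,3)[of "\<rho> n"] less_trans[OF tuv(4) elim(1)] by simp
    from m(3)[OF gX(1) near inv_T[OF g(1)] gX(2) this] show False
      using elim(3) unfolding g by (simp add: dist_commute)
  qed
  then show False
    by simp
qed

end

section \<open>The orbit hull as a compact set of functions\<close>

lemma limitin_pointwise_iff:
  "limitin (pointwise_topology G) f l F \<longleftrightarrow>
     l \<in> Linf G \<and> (\<forall>\<^sub>F n in F. f n \<in> Linf G) \<and> (\<forall>x\<in>carrier G. ((\<lambda>n. f n x) \<longlongrightarrow> l x) F)"
proof -
  have "Linf G \<subseteq> extensional (carrier G)"
    by (auto simp: Linf_iff)
  then show ?thesis
    unfolding pointwise_topology_def limitin_subtopology limitin_componentwise
    by (auto simp: PiE_def elim: eventually_mono)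
qed

text \<open>Extensional functions have the fixed value \<open>undefined\<close> off
  \<open>S\<close>, so inclusion and restriction are continuous both ways between the product over
  \<open>S\<close> and the full function space. Hulls can thus be treated with the type-class
  notions of closure and compactness.\<close>

lemma closure_of_product_extensional:
  fixes A :: "('a \<Rightarrow> real) set"
  assumes "A \<subseteq> extensional S"
  shows "product_topology (\<lambda>_. euclideanreal) S closure_of A = closure A"
proof
  let ?P = "product_topology (\<lambda>_. euclideanreal) S"
  have "continuous_map ?P (product_topology (\<lambda>_. euclideanreal) UNIV) (\<lambda>f. f)"
  proof (unfold continuous_map_componentwise_UNIV, intro allI)
    fix k
    show "continuous_map ?P euclideanreal (\<lambda>f. f k)"
    proof (cases "k \<in> S")
      case False
      have "continuous_map ?P euclideanreal (\<lambda>f. undefined)"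
        by simp
      then show ?thesis
        by (rule continuous_map_eq) (use False in \<open>auto simp: PiE_def extensional_def\<close>)
    next
      case True
      then show ?thesis
        by (rule continuous_map_product_coordinates)
    qed
  qed
  then have "continuous_map ?P euclidean (\<lambda>f. f)"
    by (simp add: euclidean_product_topology)
  from continuous_map_image_closure_subset[OF this, of A]
  show "?P closure_of A \<subseteq> closure A"
    by simp
  have cont: "continuous_map euclidean ?P (\<lambda>f. restrict f S)"
    unfolding continuous_map_componentwise
    by (auto simp: extensional_def)
  have ext: "closed (extensional S :: ('a \<Rightarrow> real) set)"
  proof -
    have "extensional S = (\<Inter>k\<in>-S. {f :: 'a \<Rightarrow> real. f k = undefined})"
      by (auto simp: extensional_def)
    moreover have "closed {f :: 'a \<Rightarrow> real. f k = undefined}" for k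
      by (intro closed_Collect_eq continuous_on_product_coordinates continuous_on_const)
    ultimately show ?thesis
      by (simp add: closed_INT)
  qed
  have eq: "(\<lambda>f. restrict f S) ` B = B" if "B \<subseteq> extensional S" for B :: "('a \<Rightarrow> real) set"
    using that by (force simp: extensional_restrict image_iff)
  have "closure A \<subseteq> extensional S"
    using assms ext by (rule closure_minimal)
  with continuous_map_image_closure_subset[OF cont, of A] assms
  show "closure A \<subseteq> ?P closure_of A"
    by (simp add: eq)
qed

lemma translate_apply [simp]: "x \<in> carrier G \<Longrightarrow> translate G t f x = f (x \<otimes>\<^bsub>G\<^esub> t)"
  by (simp add: translate_def)

lemma translate_extensional [simp]: "translate G t f \<in> extensional (carrier G)"
  by (simp add: translate_def)

section \<open>Translations and their orbit hulls\<close>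

context group
begin

lemma translate_Linf:
  assumes "f \<in> Linf G" "t \<in> carrier G"
  shows "translate G t f \<in> Linf G"
  using assms unfolding Linf_iff by (auto intro: exI)

lemma translate_translate:
  assumes "s \<in> carrier G" "t \<in> carrier G"
  shows "translate G s (translate G t f) = translate G (s \<otimes> t) f"
  using assms by (intro extensionalityI[of _ "carrier G"]) (auto simp: m_assoc)

lemma translate_one:
  assumes "f \<in> extensional (carrier G)"
  shows "translate G \<one> f = f"
  using assms by (intro extensionalityI[of _ "carrier G"]) auto

text \<open>All translates share the bound of \<xi>, so they lie in a product of compact intervals,
  with a one-point factor at each index off the carrier; Tychonoff's theorem applies. The common
  bound also keeps pointwise limits inside \<open>Linf G\<close>.\<close>

lemma orbit_subset_compact_Linf:
  assumes "\<xi> \<in> Linf G" "S \<subseteq> carrier G"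
  obtains C where "compact C" "closed C" "(\<lambda>t. translate G t \<xi>) ` S \<subseteq> C" "C \<subseteq> Linf G"
proof -
  obtain B where B: "\<And>x. x \<in> carrier G \<Longrightarrow> \<bar>\<xi> x\<bar> \<le> B"
    using assms(1) by (auto simp: Linf_iff)
  define C where "C = PiE UNIV (\<lambda>x. if x \<in> carrier G then {-B..B} else {undefined})"
  have "compactin (product_topology (\<lambda>_. euclideanreal) UNIV) C"
    unfolding C_def compactin_PiE by auto
  then have "compact C"
    by (simp add: euclidean_product_topology)
  moreover have "closed C"
  proof -
    have "closedin (product_topology (\<lambda>_. euclideanreal) UNIV) C"
      unfolding C_def closedin_product_topology by auto
    then show ?thesis
      by (simp add: euclidean_product_topology)
  qed
  moreover have "translate G t \<xi> \<in> C" if "t \<in> S" for t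
    using B assms(2) that by (auto simp: C_def translate_def abs_le_iff minus_le_iff subset_iff)
  moreover have "C \<subseteq> Linf G"
  proof
    fix f assume "f \<in> C"
    then have f: "f x \<in> (if x \<in> carrier G then {-B..B} else {undefined})" for x
      unfolding C_def by (rule PiE_mem) simp
    have "\<bar>f x\<bar> \<le> B" if "x \<in> carrier G" for x
      using f[of x] that by auto
    moreover have "f \<in> extensional (carrier G)"
    proof (unfold extensional_def, intro CollectI allI impI)
      show "f x = undefined" if "x \<notin> carrier G" for x
        using f[of x] that by simp
    qed
    ultimately show "f \<in> Linf G"
      by (auto simp: Linf_iff)
  qed
  ultimately show thesis
    using that by blast
qed

lemma orbit_hull_eq_closure:
  assumes "\<xi> \<in> Linf G" "S \<subseteq> carrier G"
  shows "orbit_hull G S \<xi> = closure ((\<lambda>t. translate G t \<xi>) ` S)"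
proof -
  let ?O = "(\<lambda>t. translate G t \<xi>) ` S"
  obtain C where C: "compact C" "closed C" "?O \<subseteq> C" "C \<subseteq> Linf G"
    using orbit_subset_compact_Linf[OF assms] .
  have "closure ?O \<subseteq> Linf G"
    using closure_minimal[OF C(3,2)] C(4) by blast
  moreover have "?O \<subseteq> Linf G" "?O \<subseteq> extensional (carrier G)"
    using C by auto
  ultimately show ?thesis
    unfolding orbit_hull_def pointwise_topology_def closure_of_subtopology
    by (simp add: closure_of_product_extensional Int_absorb1 Int_absorb2)
qed

lemma compact_orbit_hull:
  assumes "\<xi> \<in> Linf G" "S \<subseteq> carrier G"
  shows "compact (orbit_hull G S \<xi>)" "orbit_hull G S \<xi> \<subseteq> Linf G"
proof -
  let ?O = "(\<lambda>t. translate G t \<xi>) ` S"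
  obtain C where C: "compact C" "closed C" "?O \<subseteq> C" "C \<subseteq> Linf G"
    using orbit_subset_compact_Linf[OF assms] .
  have "closure ?O \<subseteq> C"
    using C by (intro closure_minimal)
  moreover from this have "closure ?O = C \<inter> closure ?O"
    by blast
  then have "compact (closure ?O)"
    using compact_Int_closed[OF C(1) closed_closure, of ?O] by simp
  ultimately show "compact (orbit_hull G S \<xi>)" "orbit_hull G S \<xi> \<subseteq> Linf G"
    using C(4) by (auto simp: orbit_hull_eq_closure[OF assms])
qed

lemma continuous_translate:
  assumes "t \<in> carrier G"
  shows "continuous_on A (translate G t)"
proof (rule continuous_on_coordinatewise_then_product)
  fix x
  show "continuous_on A (\<lambda>f. translate G t f x)"
    by (cases "x \<in> carrier G")
      (auto simp: translate_def intro: continuous_on_subset[OF continuous_on_product_coordinates])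
qed

lemma orbit_hull_translate:
  assumes "\<xi> \<in> Linf G" "subgroup S G" "f \<in> orbit_hull G S \<xi>" "t \<in> S"
  shows "translate G t f \<in> orbit_hull G S \<xi>"
proof -
  have S: "S \<subseteq> carrier G" "\<And>s. s \<in> S \<Longrightarrow> t \<otimes> s \<in> S"
    using assms by (auto simp: subgroup_def)
  let ?O = "(\<lambda>t. translate G t \<xi>) ` S"
  have "translate G t ` closure ?O \<subseteq> closure (translate G t ` ?O)"
    using assms(4) S(1)
    by (intro image_closure_subset[of ?O] continuous_translate closed_closure closure_subset) auto
  also have "translate G t ` ?O \<subseteq> ?O"
    using S assms(4) by (auto simp: translate_translate subset_iff)
  then have "closure (translate G t ` ?O) \<subseteq> closure ?O"
    by (rule closure_mono)
  finally show ?thesis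
    using assms(3) S by (auto simp: orbit_hull_eq_closure[OF assms(1)])
qed

text \<open>Compactness arguments below refine filters instead of passing to subnets; this lemma
  turns such data back into a net to which almost automorphy applies.\<close>

lemma T_aa_filter:
  fixes F :: "'i filter"
  assumes aa: "T_aa G T f" and "T \<subseteq> carrier G" and "F \<noteq> bot"
    and t: "\<forall>\<^sub>F i in F. t i \<in> T" and "\<eta> \<in> Linf G" "g \<in> Linf G"
    and lim1: "\<And>x. x \<in> carrier G \<Longrightarrow> ((\<lambda>i. f (x \<otimes> t i)) \<longlongrightarrow> \<eta> x) F"
    and lim2: "\<And>x. x \<in> carrier G \<Longrightarrow> ((\<lambda>i. \<eta> (x \<otimes> inv (t i))) \<longlongrightarrow> g x) F"
  shows "f = g"
proof -
  \<comment> \<open>This is the usual net of a filter: pointed members ordered by reverse inclusion.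
    Only members on which t stays in \<open>T\<close> are used, since the net must lie in
    \<open>T\<close> at every index and not just eventually.\<close>
  define I where "I = {(A, i). eventually (\<lambda>i. i \<in> A) F \<and> i \<in> A \<and> (\<forall>i\<in>A. t i \<in> T)}"
  define r :: "'i set \<times> 'i \<Rightarrow> 'i set \<times> 'i \<Rightarrow> bool" where "r a b \<longleftrightarrow> fst b \<subseteq> fst a" for a b
  have ex: "\<exists>i. (A, i) \<in> I" if "eventually (\<lambda>i. i \<in> A) F" "\<forall>i\<in>A. t i \<in> T" for A
    using eventually_happens'[OF \<open>F \<noteq> bot\<close> that(1)] that by (auto simp: I_def)
  have dir: "directed_set I r"
    unfolding directed_set_def
  proof (intro conjI ballI impI)
    show "I \<noteq> {}"
    proof -
      have "eventually (\<lambda>i. i \<in> {i. t i \<in> T}) F"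
        using t by simp
      from ex[OF this] show ?thesis
        by blast
    qed
  next
    fix a b assume ab: "a \<in> I" "b \<in> I"
    then have "eventually (\<lambda>i. i \<in> fst a \<inter> fst b) F" "\<forall>i\<in>fst a \<inter> fst b. t i \<in> T"
      by (auto simp: I_def eventually_conj_iff)
    from ex[OF this] obtain i where "(fst a \<inter> fst b, i) \<in> I" ..
    then show "\<exists>k\<in>I. r a k \<and> r b k"
      by (rule bexI[rotated]) (simp add: r_def)
  qed (auto simp: r_def)
  have lim: "((\<lambda>n. h (snd n)) \<longlongrightarrow> (l :: real)) (tails I r)" if "(h \<longlongrightarrow> l) F" for h l
  proof (rule tendstoI)
    fix e :: real assume "e > 0"
    define A where "A = {i. dist (h i) l < e \<and> t i \<in> T}"
    have "eventually (\<lambda>i. i \<in> A) F"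
      using tendstoD[OF that \<open>e > 0\<close>] t by (simp add: A_def eventually_conj_iff)
    moreover have "\<forall>i\<in>A. t i \<in> T"
      by (simp add: A_def)
    ultimately obtain i where "(A, i) \<in> I"
      using ex by blast
    moreover have "dist (h (snd n)) l < e" if "n \<in> I" "r (A, i) n" for n
      using that by (auto simp: I_def r_def A_def)
    ultimately show "\<forall>\<^sub>F n in tails I r. dist (h (snd n)) l < e"
      unfolding eventually_tails[OF dir] by blast
  qed
  have I: "t (snd n) \<in> T" "t (snd n) \<in> carrier G" if "n \<in> I" for n
    using that \<open>T \<subseteq> carrier G\<close> by (auto simp: I_def)
  have evI: "\<forall>\<^sub>F n in tails I r. P n" if "\<And>n. n \<in> I \<Longrightarrow> P n" for P
  proof -
    obtain i where "i \<in> I"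
      using dir by (auto simp: directed_set_def)
    then show ?thesis
      unfolding eventually_tails[OF dir] using that by blast
  qed
  have "f \<in> Linf G"
    using aa by (simp add: T_aa_def)
  \<comment> \<open>The equation \<open>translate G (t n) (f' n) = \<eta>\<close> is solved by
    translating \<eta> with the inverse element.\<close>
  show ?thesis
  proof (rule T_aa_net[OF aa dir, of "\<lambda>n. t (snd n)" "\<lambda>n. translate G (inv (t (snd n))) \<eta>" \<eta>])
    show "limitin (pointwise_topology G) (\<lambda>n. translate G (t (snd n)) f) \<eta> (tails I r)"
      using \<open>\<eta> \<in> Linf G\<close> \<open>f \<in> Linf G\<close> lim[OF lim1] I
      by (auto simp: limitin_pointwise_iff intro!: evI translate_Linf)
    show "limitin (pointwise_topology G) (\<lambda>n. translate G (inv (t (snd n))) \<eta>) g (tails I r)"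
      using \<open>\<eta> \<in> Linf G\<close> \<open>g \<in> Linf G\<close> lim[OF lim2] I
      by (auto simp: limitin_pointwise_iff intro!: evI translate_Linf)
    show "translate G (t (snd n)) (translate G (inv (t (snd n))) \<eta>) = \<eta>" if "n \<in> I" for n
      using I[OF that] \<open>\<eta> \<in> Linf G\<close> by (simp add: translate_translate translate_one Linf_iff)
  qed (use I \<open>\<eta> \<in> Linf G\<close> in \<open>auto intro: translate_Linf\<close>)
qed

text \<open>Every generated element is the product of a finite word in \<open>A\<close> and the
  inverses of \<open>A\<close>, and there are only countably many such words.\<close>

lemma countable_generate:
  assumes "countable A" "A \<subseteq> carrier G"
  shows "countable (generate G A)"
proof -
  define w :: "'a list \<Rightarrow> 'a" where "w = (\<lambda>xs. foldr (\<otimes>) xs \<one>)"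
  define L where "L = lists (A \<union> (\<lambda>a. inv a) ` A)"
  have L: "set xs \<subseteq> carrier G" if "xs \<in> L" for xs
    using that assms(2) by (auto simp: L_def lists_eq_set)
  have w: "w xs \<in> carrier G" if "set xs \<subseteq> carrier G" for xs
    using that by (induction xs) (auto simp: w_def)
  have app: "w (xs @ ys) = w xs \<otimes> w ys" if "set xs \<subseteq> carrier G" "set ys \<subseteq> carrier G" for xs ys
    using that
  proof (induction xs)
    case Nil
    then show ?case
      using w[of ys] by (simp add: w_def)
  next
    case (Cons x xs)
    then show ?case
      using w[of xs] w[of ys] by (simp add: w_def m_assoc)
  qed
  have "generate G A \<subseteq> w ` L"
  proof
    fix x assume "x \<in> generate G A"
    then show "x \<in> w ` L"
    proof induction
      case one
      have "\<one> = w []" "[] \<in> L"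
        by (auto simp: w_def L_def)
      then show ?case by (rule image_eqI)
    next
      case (incl h)
      then have "h = w [h]" "[h] \<in> L"
        using assms(2) by (auto simp: w_def L_def)
      then show ?case by (rule image_eqI)
    next
      case (inv h)
      then have "inv h = w [inv h]" "[inv h] \<in> L"
        using assms(2) by (auto simp: w_def L_def)
      then show ?case by (rule image_eqI)
    next
      case (eng h1 h2)
      then obtain xs ys where "xs \<in> L" "ys \<in> L" "h1 = w xs" "h2 = w ys"
        by blast
      then have "h1 \<otimes> h2 = w (xs @ ys)" "xs @ ys \<in> L"
        using L by (auto simp: app L_def)
      then show ?case by (rule image_eqI)
    qed
  qed
  moreover have "countable L"
    using assms(1) by (simp add: L_def)
  ultimately show ?thesis
    by (meson countable_image countable_subset)
qed

end

section \<open>Almost periodic versus almost automorphic functions\<close>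

text \<open>This replaces the choice of a convergent subnet: F is intersected with the pullback
  under f of the neighbourhoods of a cluster point.\<close>

lemma compact_filter_cluster:
  assumes "compact H" "F \<noteq> bot" "\<forall>\<^sub>F i in F. f i \<in> H"
  obtains F' l where "F' \<le> F" "F' \<noteq> bot" "l \<in> H" "(f \<longlongrightarrow> l) F'"
proof -
  have "filtermap f F \<noteq> bot" "\<forall>\<^sub>F x in filtermap f F. x \<in> H"
    using assms by (simp_all add: filtermap_bot_iff eventually_filtermap)
  then obtain l where l: "l \<in> H" "inf (nhds l) (filtermap f F) \<noteq> bot"
    using assms(1) unfolding compact_filter by blast
  define F' where "F' = inf F (filtercomap f (nhds l))"
  have "F' \<noteq> bot"
  proof
    assume "F' = bot"
    then obtain P Q where PQ: "eventually P F" "eventually Q (nhds l)" "\<And>i. P i \<Longrightarrow> \<not> Q (f i)"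
      unfolding F'_def trivial_limit_def eventually_inf eventually_filtercomap by blast
    then have "\<forall>\<^sub>F x in filtermap f F. \<not> Q x"
      by (auto simp: eventually_filtermap elim: eventually_mono)
    with PQ(2) have "\<forall>\<^sub>F x in inf (nhds l) (filtermap f F). False"
      unfolding eventually_inf by blast
    with l(2) show False
      by (simp add: trivial_limit_def)
  qed
  moreover have "(f \<longlongrightarrow> l) F'"
    unfolding F'_def by (rule filterlim_mono[OF filterlim_filtercomap order_refl]) simp
  ultimately show thesis
    using that[of F' l] l(1) by (simp add: F'_def)
qed

lemma tendsto_fun_apply:
  fixes f :: "'i \<Rightarrow> 'a \<Rightarrow> real"
  assumes "(f \<longlongrightarrow> l) F"
  shows "((\<lambda>i. f i x) \<longlongrightarrow> l x) F"
  using continuous_on_tendsto_compose[OF continuous_on_product_coordinates[of x] assms] by simp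

lemma T_aa_mono:
  assumes "T_aa G T f" "S \<subseteq> T"
  shows "T_aa G S f"
proof -
  have "f = g" if "directed_set I r" "\<forall>n\<in>I. t n \<in> S" "\<forall>n\<in>I. f' n \<in> Linf G"
    "limitin (pointwise_topology G) (\<lambda>n. translate G (t n) f) \<eta> (tails I r)"
    "limitin (pointwise_topology G) f' g (tails I r)" "\<forall>n\<in>I. translate G (t n) (f' n) = \<eta>"
    for I :: "'a net_index set" and r t f' \<eta> g
    by (rule T_aa_net[OF assms(1) that(1) _ _ that(4,5)]) (use assms(2) that in auto)
  then show ?thesis
    using assms(1) unfolding T_aa_def by blast
qed

section \<open>Equicontinuity over a countable subgroup\<close>

context group
begin

text \<open>Restricting the hull to a countable set of points yields a compact flow of real
  sequences, hence a metric one. A convergent subsequence of the orbit is Cauchy there, and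
  equicontinuity makes the estimate uniform over \<open>S\<close>.\<close>

lemma countable_orbit_equicontinuous:
  assumes \<xi>: "\<xi> \<in> Linf G" and S: "subgroup S G" "countable S"
    and K: "finite K" "K \<subseteq> carrier G"
    and hull: "\<And>f. f \<in> orbit_hull G S \<xi> \<Longrightarrow> T_aa G S f"
    and t: "\<And>n::nat. t n \<in> S"
  obtains \<rho> :: "nat \<Rightarrow> nat" where "strict_mono \<rho>"
    "\<And>e. e > 0 \<Longrightarrow> \<exists>N. \<forall>m\<ge>N. \<forall>n\<ge>N. \<forall>k\<in>K. \<forall>s\<in>S. \<bar>\<xi> (k \<otimes> s \<otimes> t (\<rho> m)) - \<xi> (k \<otimes> s \<otimes> t (\<rho> n))\<bar> < e"
proof -
  have ST: "S \<subseteq> carrier G" "\<one> \<in> S" "\<And>s. s \<in> S \<Longrightarrow> s \<in> carrier G" "\<And>s t. s \<in> S \<Longrightarrow> t \<in> S \<Longrightarrow> s \<otimes> t \<in> S"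
    "\<And>s. s \<in> S \<Longrightarrow> inv s \<in> S"
    using S(1) by (auto simp: subgroup_def)
  define H where "H = orbit_hull G S \<xi>"
  have H: "compact H" "H \<subseteq> Linf G" "H = closure ((\<lambda>t. translate G t \<xi>) ` S)"
    using compact_orbit_hull[OF \<xi> ST(1)] orbit_hull_eq_closure[OF \<xi> ST(1)] by (simp_all add: H_def)
  have orbit: "translate G s \<xi> \<in> H" if "s \<in> S" for s
    using subsetD[OF closure_subset imageI[OF that, of "\<lambda>t. translate G t \<xi>"]] by (simp add: H(3))
  have H_translate: "translate G s f \<in> H" if "f \<in> H" "s \<in> S" for f s
    using orbit_hull_translate[OF \<xi> S(1)] that by (simp add: H_def)
  have ext: "f \<in> extensional (carrier G)" if "f \<in> H" for f
    using that H(2) by (auto simp: Linf_iff)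
  \<comment> \<open>The set holds all points of the required estimate and is stable under right
    multiplication by \<open>S\<close>, so translations act on restrictions to it. Inserting the
    unit keeps it nonempty even if \<open>K\<close> is empty.\<close>
  define C where "C = (\<lambda>(k, s). k \<otimes> s) ` (insert \<one> K \<times> S)"
  have C: "countable C" "C \<noteq> {}" "C \<subseteq> carrier G"
    using K S(2) ST by (auto simp: C_def intro: countable_finite)
  have C_mult: "x \<otimes> s \<in> C" if x: "x \<in> C" and s: "s \<in> S" for x s
  proof -
    obtain k s' where k: "k \<in> insert \<one> K" "s' \<in> S" "x = k \<otimes> s'"
      using x by (auto simp: C_def)
    then have "x \<otimes> s = k \<otimes> (s' \<otimes> s)"
      using s K(2) ST(3) by (auto simp: m_assoc subset_iff)
    then show ?thesis
      using k s ST(4) unfolding C_def by (intro image_eqI[of _ _ "(k, s' \<otimes> s)"]) auto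
  qed
  have KC: "k \<in> C" if "k \<in> K" for k
    using that K(2) ST(2) unfolding C_def by (intro image_eqI[of _ _ "(k, \<one>)"]) auto
  define e where "e = from_nat_into C"
  define idx where "idx = to_nat_on C"
  have e: "e n \<in> C" for n
    using from_nat_into[OF C(2)] by (simp add: e_def)
  have e_carrier: "e n \<in> carrier G" for n
    using e C(3) by blast
  have e_idx: "e (idx x) = x" if "x \<in> C" for x
    using from_nat_into_to_nat_on[OF C(1) that] by (simp add: e_def idx_def)
  \<comment> \<open>Sequences are used because \<open>nat \<Rightarrow> real\<close> is a metric
    space. The enumeration e may repeat values, so \<open>act\<close> is a genuine action only on
    sequences of the form \<open>pr f\<close>.\<close>
  define pr :: "('a \<Rightarrow> real) \<Rightarrow> nat \<Rightarrow> real" where "pr f = (\<lambda>n. f (e n))" for f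
  define act :: "'a \<Rightarrow> (nat \<Rightarrow> real) \<Rightarrow> nat \<Rightarrow> real" where "act s u = (\<lambda>n. u (idx (e n \<otimes> s)))" for s u
  have act_pr: "act s (pr f) = pr (translate G s f)" if "s \<in> S" for s f
    using that by (simp add: act_def pr_def e_idx C_mult e e_carrier)
  have pr_cont: "continuous_on A pr" for A
    unfolding pr_def
    by (intro continuous_on_coordinatewise_then_product continuous_on_subset[OF continuous_on_product_coordinates subset_UNIV])
  have pr_lim: "((\<lambda>i. pr (f i)) \<longlongrightarrow> pr l) F" if "(f \<longlongrightarrow> l) F" for f l and F :: "nat filter"
    using continuous_on_tendsto_compose[OF pr_cont that, of UNIV] by simp
  define X where "X = pr ` H"
  interpret compact_aa_flow G S act X "pr \<xi>"
  proof (intro compact_aa_flow.intro compact_aa_flow_axioms.intro)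
    show "Group.group G" by (rule is_group)
    show "subgroup S G" by (rule S(1))
    show "compact X"
      unfolding X_def using pr_cont H(1) by (rule compact_continuous_image)
    show "pr \<xi> \<in> X"
      using orbit[OF ST(2)] \<xi> by (simp add: X_def translate_one Linf_iff)
    show "act s x \<in> X" if "s \<in> S" "x \<in> X" for s x
      using that by (auto simp: X_def act_pr H_translate)
    show "continuous_on X (act s)" if "s \<in> S" for s
      unfolding act_def
      by (intro continuous_on_coordinatewise_then_product continuous_on_subset[OF continuous_on_product_coordinates subset_UNIV])
    show "act (s \<otimes> s') x = act s (act s' x)" if "s \<in> S" "s' \<in> S" "x \<in> X" for s s' x
      using that by (auto simp: X_def act_pr translate_translate ST)
    show "act \<one> x = x" if "x \<in> X" for x
      using that ST(2) by (auto simp: X_def act_pr translate_one ext)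
    have "pr ` closure ((\<lambda>t. translate G t \<xi>) ` S) \<subseteq> closure ((\<lambda>t. act t (pr \<xi>)) ` S)"
      by (intro image_closure_subset[OF pr_cont closed_closure] order_trans[OF _ closure_subset])
        (auto simp: act_pr)
    then show "X \<subseteq> closure ((\<lambda>t. act t (pr \<xi>)) ` S)"
      by (simp add: X_def H(3))
    fix \<tau> :: "nat \<Rightarrow> 'a" and x y z
    assume \<tau>: "\<And>n. \<tau> n \<in> S" and xyz: "x \<in> X" "y \<in> X" "z \<in> X"
      and lim: "(\<lambda>n. act (\<tau> n) x) \<longlonglongrightarrow> y" "(\<lambda>n. act (inv (\<tau> n)) y) \<longlonglongrightarrow> z"
    \<comment> \<open>Restriction may lose information, so the limits are lifted to the full hull:
      cluster points \<eta> and g along finer filters must project to y and z, and almost automorphy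
      of f upstairs gives f = g.\<close>
    obtain f where f: "f \<in> H" "x = pr f"
      using xyz by (auto simp: X_def)
    have "\<forall>\<^sub>F n in sequentially. translate G (\<tau> n) f \<in> H"
      using f \<tau> by (simp add: H_translate)
    from compact_filter_cluster[OF H(1) sequentially_bot this]
    obtain F1 \<eta> where F1: "F1 \<le> sequentially" "F1 \<noteq> bot" "\<eta> \<in> H" "((\<lambda>n. translate G (\<tau> n) f) \<longlongrightarrow> \<eta>) F1"
      by blast
    have "\<forall>\<^sub>F n in F1. translate G (inv (\<tau> n)) \<eta> \<in> H"
      using F1(3) \<tau> by (simp add: H_translate ST)
    from compact_filter_cluster[OF H(1) F1(2) this]
    obtain F2 g where F2: "F2 \<le> F1" "F2 \<noteq> bot" "g \<in> H" "((\<lambda>n. translate G (inv (\<tau> n)) \<eta>) \<longlongrightarrow> g) F2"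
      by blast
    have "((\<lambda>n. act (\<tau> n) x) \<longlongrightarrow> pr \<eta>) F1"
      using pr_lim[OF F1(4)] \<tau> by (simp add: f act_pr)
    then have y: "y = pr \<eta>"
      using tendsto_unique[OF F1(2) tendsto_mono[OF F1(1) lim(1)]] by simp
    have "((\<lambda>n. act (inv (\<tau> n)) y) \<longlongrightarrow> pr g) F2"
      using pr_lim[OF F2(4)] \<tau> ST(5) by (simp add: y act_pr)
    then have z: "z = pr g"
      using tendsto_unique[OF F2(2) tendsto_mono[OF order_trans[OF F2(1) F1(1)] lim(2)]] by simp
    have "f = g"
    proof (rule T_aa_filter[OF hull ST(1) F2(2), of f \<tau> \<eta> g])
      show "f \<in> orbit_hull G S \<xi>" "\<eta> \<in> Linf G" "g \<in> Linf G" "\<forall>\<^sub>F i in F2. \<tau> i \<in> S"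
        using f F1(3) F2(3) H(2) \<tau> by (auto simp: H_def)
      show "((\<lambda>i. f (x \<otimes> \<tau> i)) \<longlongrightarrow> \<eta> x) F2" if "x \<in> carrier G" for x
        using tendsto_fun_apply[OF tendsto_mono[OF F2(1) F1(4)], of x] that by simp
      show "((\<lambda>i. \<eta> (x \<otimes> inv (\<tau> i))) \<longlongrightarrow> g x) F2" if "x \<in> carrier G" for x
        using tendsto_fun_apply[OF F2(4), of x] that by simp
    qed
    then show "x = z"
      by (simp add: f z)
  qed
  define u where "u n = pr (translate G (t n) \<xi>)" for n
  have u: "u n \<in> X" for n
    using orbit[OF t] by (simp add: u_def X_def)
  then have "\<forall>n. u n \<in> X"
    by simp
  then obtain l \<rho> where \<rho>: "strict_mono \<rho>" "(u \<circ> \<rho>) \<longlonglongrightarrow> l"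
    by (rule seq_compactE[OF compact_imp_seq_compact[OF compact_X]])
  have "\<exists>N. \<forall>m\<ge>N. \<forall>n\<ge>N. \<forall>k\<in>K. \<forall>s\<in>S. \<bar>\<xi> (k \<otimes> s \<otimes> t (\<rho> m)) - \<xi> (k \<otimes> s \<otimes> t (\<rho> n))\<bar> < \<epsilon>"
    if "\<epsilon> > 0" for \<epsilon>
  proof -
    \<comment> \<open>Only the finitely many coordinates of \<open>K\<close> have to be controlled:
      the value of \<xi> at \<open>k \<otimes> s \<otimes> t n\<close> is coordinate
      \<open>idx k\<close> of \<open>act s (u n)\<close>.\<close>
    have "\<exists>d>0. \<forall>k\<in>K. \<forall>v\<in>X. \<forall>w\<in>X. dist v w < d \<longrightarrow> \<bar>v (idx k) - w (idx k)\<bar> < \<epsilon>"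
      using K(1)
    proof induction
      case empty
      then show ?case
        by (intro exI[of _ 1]) simp
    next
      case (insert k K)
      have "uniformly_continuous_on X (\<lambda>v. v (idx k))"
        by (intro compact_uniformly_continuous compact_X continuous_on_subset[OF continuous_on_product_coordinates subset_UNIV])
      then obtain d where d: "d > 0" "\<And>v w. v \<in> X \<Longrightarrow> w \<in> X \<Longrightarrow> dist v w < d \<Longrightarrow> \<bar>v (idx k) - w (idx k)\<bar> < \<epsilon>"
        using \<open>\<epsilon> > 0\<close> unfolding uniformly_continuous_on_def dist_real_def by (metis dist_commute)
      obtain d' where "d' > 0" "\<forall>k\<in>K. \<forall>v\<in>X. \<forall>w\<in>X. dist v w < d' \<longrightarrow> \<bar>v (idx k) - w (idx k)\<bar> < \<epsilon>"
        using insert.IH by blast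
      with d show ?case
        by (intro exI[of _ "min d d'"]) auto
    qed
    then obtain d where d: "d > 0" "\<And>k v w. \<lbrakk>k \<in> K; v \<in> X; w \<in> X; dist v w < d\<rbrakk> \<Longrightarrow> \<bar>v (idx k) - w (idx k)\<bar> < \<epsilon>"
      by blast
    obtain c where c: "c > 0" "\<And>s v w. \<lbrakk>s \<in> S; v \<in> X; w \<in> X; dist v w < c\<rbrakk> \<Longrightarrow> dist (act s v) (act s w) < d"
      using equicontinuous[OF d(1)] by blast
    obtain N where N: "\<And>m n. m \<ge> N \<Longrightarrow> n \<ge> N \<Longrightarrow> dist (u (\<rho> m)) (u (\<rho> n)) < c"
      using LIMSEQ_imp_Cauchy[OF \<rho>(2)] c(1) unfolding Cauchy_def comp_def by blast
    have "\<bar>\<xi> (k \<otimes> s \<otimes> t (\<rho> m)) - \<xi> (k \<otimes> s \<otimes> t (\<rho> n))\<bar> < \<epsilon>"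
      if "m \<ge> N" "n \<ge> N" "k \<in> K" "s \<in> S" for m n k s
    proof -
      have eq: "act s (u n) (idx k) = \<xi> (k \<otimes> s \<otimes> t n)" for n
        using that t K(2) ST(3) by (simp add: u_def act_pr) (auto simp: pr_def e_idx KC subset_iff)
      have "\<bar>act s (u (\<rho> m)) (idx k) - act s (u (\<rho> n)) (idx k)\<bar> < \<epsilon>"
        using that u by (intro d(2) c(2) N act_closed)
      then show ?thesis
        by (simp only: eq)
    qed
    then show ?thesis
      by blast
  qed
  with \<rho>(1) show thesis
    by (rule that)
qed

section \<open>Precompactness in the supremum norm\<close>

lemma mdist_Linf_le_iff:
  assumes "f \<in> Linf G" "g \<in> Linf G"
  shows "mdist (Linf_metric G) f g \<le> a \<longleftrightarrow> (\<forall>x\<in>carrier G. \<bar>f x - g x\<bar> \<le> a)"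
  using funspace_mdist_le[of f "carrier G" euclidean_metric g a] assms carrier_not_empty
  by (simp add: Linf_def Linf_metric_def dist_real_def del: mdist_funspace mspace_funspace)

lemma abs_diff_le_mdist:
  assumes "f \<in> Linf G" "g \<in> Linf G" "x \<in> carrier G"
  shows "\<bar>f x - g x\<bar> \<le> mdist (Linf_metric G) f g"
  using mdist_Linf_le_iff[OF assms(1,2)] assms(3) by blast

text \<open>\<open>Linf G\<close> is complete, so compact closure means total boundedness. One
  direction of the main equivalence then works with finite nets, the other with Cauchy
  subsequences.\<close>

lemma bochner_ap_iff_mtotally_bounded:
  assumes "\<xi> \<in> Linf G" "S \<subseteq> carrier G"
  shows "bochner_ap G S \<xi> \<longleftrightarrow>
    Metric_space.mtotally_bounded (Linf G) (mdist (Linf_metric G)) ((\<lambda>t. translate G t \<xi>) ` S)"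
proof -
  interpret L: Metric_space "Linf G" "mdist (Linf_metric G)"
    unfolding Linf_def by (rule Metric_space_mspace_mdist)
  have "Met_TC.mcomplete (TYPE(real))"
    by (simp add: complete_UNIV)
  from Met_TC.mcomplete_funspace[OF this, of "carrier G"] have "L.mcomplete"
    by (simp add: mcomplete_of_def Linf_def Linf_metric_def euclidean_metric_def Met_TC.Self_def)
  moreover have "(\<lambda>t. translate G t \<xi>) ` S \<subseteq> Linf G"
    using assms translate_Linf by blast
  moreover have "mtopology_of (Linf_metric G) = L.mtopology"
    by (simp add: mtopology_of_def Linf_def)
  ultimately show ?thesis
    using assms(1) L.mtotally_bounded_eq_compact_closure_of unfolding bochner_ap_def by simp
qed

text \<open>A finite uniform net of the orbit serves the whole pointwise hull. Among finitely many
  candidates, pointwise convergence at finitely many points already decides uniform closeness, so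
  the translates of f are eventually uniformly close to \<eta>; translating back compares f with
  \<open>f' n\<close>.\<close>

lemma bochner_ap_imp_T_aa:
  assumes \<xi>: "\<xi> \<in> Linf G" and T: "subgroup T G" and ap: "bochner_ap G T \<xi>"
    and f: "f \<in> orbit_hull G T \<xi>"
  shows "T_aa G T f"
proof -
  interpret L: Metric_space "Linf G" "mdist (Linf_metric G)"
    unfolding Linf_def by (rule Metric_space_mspace_mdist)
  have T_sub: "T \<subseteq> carrier G"
    using T by (simp add: subgroup_def)
  let ?O = "(\<lambda>t. translate G t \<xi>) ` T"
  have tb: "L.mtotally_bounded ?O"
    using ap bochner_ap_iff_mtotally_bounded[OF \<xi> T_sub] by simp
  have fL: "f \<in> Linf G"
    using compact_orbit_hull(2)[OF \<xi> T_sub] f by blast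
  have "f = g"
    if dir: "directed_set I r" and t: "\<forall>n\<in>I. t n \<in> T" and f': "\<forall>n\<in>I. f' n \<in> Linf G"
      and lim1: "limitin (pointwise_topology G) (\<lambda>n. translate G (t n) f) \<eta> (tails I r)"
      and lim2: "limitin (pointwise_topology G) f' g (tails I r)"
      and eq: "\<forall>n\<in>I. translate G (t n) (f' n) = \<eta>"
    for I :: "'a net_index set" and r t f' \<eta> g
  proof -
    obtain i where "i \<in> I"
      using dir by (auto simp: directed_set_def)
    then have evI: "\<forall>\<^sub>F n in tails I r. n \<in> I"
      unfolding eventually_tails[OF dir] by blast
    have "\<forall>i\<in>I. r i i"
      using dir unfolding directed_set_def by (elim conjE)
    then have nbot: "tails I r \<noteq> bot"
      unfolding trivial_limit_def eventually_tails[OF dir] by blast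
    have g: "g \<in> Linf G"
      using lim2 by (simp add: limitin_pointwise_iff)
    have close: "\<bar>f y - g y\<bar> \<le> 3 * e" if "e > 0" "y \<in> carrier G" for e y
    proof -
      from tb[unfolded L.mtotally_bounded_def, rule_format, OF \<open>e > 0\<close>]
      obtain K where K: "finite K" "K \<subseteq> ?O" "?O \<subseteq> (\<Union>a\<in>K. L.mball a e)"
        by (elim exE conjE)
      have "?O \<subseteq> (\<Union>a\<in>K. {h. \<forall>x\<in>carrier G. \<bar>h x - a x\<bar> \<le> e})"
      proof
        fix h assume "h \<in> ?O"
        then obtain a where a: "a \<in> K" "h \<in> L.mball a e"
          using K(3) by blast
        then have "\<bar>h x - a x\<bar> \<le> e" if "x \<in> carrier G" for x
          using abs_diff_le_mdist[of a h x] that by (auto simp: abs_minus_commute)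
        with a(1) show "h \<in> (\<Union>a\<in>K. {h. \<forall>x\<in>carrier G. \<bar>h x - a x\<bar> \<le> e})"
          by blast
      qed
      \<comment> \<open>Closed uniform balls are pointwise closed, so the net passes from the orbit
        to its pointwise closure.\<close>
      moreover have "closed (\<Union>a\<in>K. {h :: 'a \<Rightarrow> real. \<forall>x\<in>carrier G. \<bar>h x - a x\<bar> \<le> e})"
      proof -
        have "closed {h :: 'a \<Rightarrow> real. \<bar>h x - a x\<bar> \<le> e}" for a x
          by (intro closed_Collect_le continuous_on_rabs continuous_on_diff
              continuous_on_product_coordinates continuous_on_const)
        then have "closed {h :: 'a \<Rightarrow> real. \<forall>x\<in>carrier G. \<bar>h x - a x\<bar> \<le> e}" for a
          by (simp add: Ball_def closed_Collect_all closed_Collect_imp)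
        then show ?thesis
          using K(1) by (intro closed_UN) auto
      qed
      ultimately have net: "orbit_hull G T \<xi> \<subseteq> (\<Union>a\<in>K. {h. \<forall>x\<in>carrier G. \<bar>h x - a x\<bar> \<le> e})"
        unfolding orbit_hull_eq_closure[OF \<xi> T_sub] by (rule closure_minimal)
      \<comment> \<open>Each bad centre a has a witness \<open>p a\<close>. Once the translate of f
        is within e of \<eta> at all witnesses, its centre cannot be bad, and e + 2e gives the bound
        3e.\<close>
      define B where "B = {a\<in>K. \<exists>x\<in>carrier G. \<bar>a x - \<eta> x\<bar> > 2 * e}"
      have "\<forall>a\<in>B. \<exists>x. x \<in> carrier G \<and> \<bar>a x - \<eta> x\<bar> > 2 * e"
        by (auto simp: B_def)
      then obtain p where p: "\<And>a. a \<in> B \<Longrightarrow> p a \<in> carrier G" "\<And>a. a \<in> B \<Longrightarrow> \<bar>a (p a) - \<eta> (p a)\<bar> > 2 * e"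
        by (auto dest!: bchoice)
      have "\<forall>\<^sub>F n in tails I r. \<bar>translate G (t n) f (p a) - \<eta> (p a)\<bar> < e" if "a \<in> B" for a
        using tendstoD[OF _ \<open>e > 0\<close>, of "\<lambda>n. translate G (t n) f (p a)" "\<eta> (p a)" "tails I r"] lim1 p(1)[OF that]
        unfolding limitin_pointwise_iff dist_real_def by blast
      then have "\<forall>\<^sub>F n in tails I r. \<forall>a\<in>B. \<bar>translate G (t n) f (p a) - \<eta> (p a)\<bar> < e"
        using K(1) by (intro eventually_ball_finite) (auto simp: B_def)
      with evI have "\<forall>\<^sub>F n in tails I r. \<bar>f y - f' n y\<bar> \<le> 3 * e"
      proof eventually_elim
        case (elim n)
        have tn: "t n \<in> T" "t n \<in> carrier G"
          using t elim(1) T_sub by auto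
        obtain a where a: "a \<in> K" "\<And>x. x \<in> carrier G \<Longrightarrow> \<bar>translate G (t n) f x - a x\<bar> \<le> e"
          using orbit_hull_translate[OF \<xi> T f tn(1)] net by blast
        have "a \<notin> B"
        proof
          assume "a \<in> B"
          with p[of a] a(2)[of "p a"] elim(2) show False
            by fastforce
        qed
        \<comment> \<open>At this point the translate of f takes the value f y, and \<eta> takes the
          value \<open>f' n y\<close>.\<close>
        define x where "x = y \<otimes> inv (t n)"
        have x: "x \<in> carrier G" "x \<otimes> t n = y"
          using tn \<open>y \<in> carrier G\<close> by (simp_all add: x_def m_assoc)
        have "\<bar>a x - \<eta> x\<bar> \<le> 2 * e"
          using \<open>a \<notin> B\<close> a(1) x(1) by (force simp: B_def)
        moreover have "\<bar>f y - a x\<bar> \<le> e"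
          using a(2)[OF x(1)] x by simp
        moreover have "\<eta> x = f' n y"
          using eq elim(1) x by (metis translate_apply)
        ultimately show ?case
          by linarith
      qed
      moreover have "((\<lambda>n. \<bar>f y - f' n y\<bar>) \<longlongrightarrow> \<bar>f y - g y\<bar>) (tails I r)"
        using lim2 \<open>y \<in> carrier G\<close> by (intro tendsto_intros) (simp add: limitin_pointwise_iff)
      ultimately show ?thesis
        using tendsto_upperbound nbot by blast
    qed
    show "f = g"
    proof (rule extensionalityI)
      show "f \<in> extensional (carrier G)" "g \<in> extensional (carrier G)"
        using fL g by (auto simp: Linf_iff)
      fix y assume "y \<in> carrier G"
      have "\<bar>f y - g y\<bar> \<le> 0 + e" if "e > 0" for e
        using close[of "e/3" y] that \<open>y \<in> carrier G\<close> by simp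
      then show "f y = g y"
        using field_le_epsilon[of "\<bar>f y - g y\<bar>" 0] by simp
    qed
  qed
  then show ?thesis
    using fL unfolding T_aa_def by blast
qed

text \<open>If \<open>k \<otimes> g\<close> lies in \<open>T\<close>, then g lies in the left coset
  of \<open>inv k\<close>; the inverses of the syndetic set therefore represent all left
  cosets.\<close>

lemma syndetic_left_cosets:
  assumes "syndetic G T"
  obtains K where "finite K" "K \<subseteq> carrier G"
    "\<And>g. g \<in> carrier G \<Longrightarrow> \<exists>k\<in>K. \<exists>s\<in>T. g = k \<otimes> s"
proof -
  obtain K where K: "finite K" "K \<subseteq> carrier G" "\<And>g. g \<in> carrier G \<Longrightarrow> (K #> g) \<inter> T \<noteq> {}"
    using assms by (auto simp: syndetic_def)
  show thesis
  proof (rule that[of "(\<lambda>k. inv k) ` K"])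
    fix g assume g: "g \<in> carrier G"
    obtain k where k: "k \<in> K" "k \<otimes> g \<in> T"
      using K(3)[OF g] by (auto simp: r_coset_def)
    moreover have "g = inv k \<otimes> (k \<otimes> g)"
      using k K(2) g by (simp add: m_assoc[symmetric] subset_iff)
    ultimately show "\<exists>k\<in>(\<lambda>k. inv k) ` K. \<exists>s\<in>T. g = k \<otimes> s"
      by blast
  qed (use K in auto)
qed

text \<open>Countably many test points detect all norm distances between terms of one orbit
  sequence. A countable subgroup of \<open>T\<close> containing their \<open>T\<close>-parts and the
  translating elements inherits the hypothesis on hulls and yields a norm-Cauchy
  subsequence.\<close>

lemma T_aa_imp_bochner_ap:
  assumes \<xi>: "\<xi> \<in> Linf G" and T: "subgroup T G" and syn: "syndetic G T"
    and hull: "\<And>f. f \<in> orbit_hull G T \<xi> \<Longrightarrow> T_aa G T f"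
  shows "bochner_ap G T \<xi>"
proof -
  interpret L: Metric_space "Linf G" "mdist (Linf_metric G)"
    unfolding Linf_def by (rule Metric_space_mspace_mdist)
  have T_sub: "T \<subseteq> carrier G"
    using T by (simp add: subgroup_def)
  let ?O = "(\<lambda>t. translate G t \<xi>) ` T"
  let ?d = "mdist (Linf_metric G)"
  obtain K where K: "finite K" "K \<subseteq> carrier G" "\<And>g. g \<in> carrier G \<Longrightarrow> \<exists>k\<in>K. \<exists>s\<in>T. g = k \<otimes> s"
    using syndetic_left_cosets[OF syn] by blast
  have O_L: "?O \<subseteq> Linf G"
    using T_sub \<xi> translate_Linf by blast
  have "\<exists>\<rho>. strict_mono \<rho> \<and> L.MCauchy (\<sigma> \<circ> \<rho>)" if \<sigma>: "range \<sigma> \<subseteq> ?O" for \<sigma> :: "nat \<Rightarrow> 'a \<Rightarrow> real"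
  proof -
    have "\<forall>n. \<exists>t. t \<in> T \<and> \<sigma> n = translate G t \<xi>"
      using \<sigma> by blast
    from choice[OF this] obtain t where t: "\<And>n. t n \<in> T" "\<And>n. \<sigma> n = translate G (t n) \<xi>"
      by blast
    have \<sigma>L: "\<sigma> n \<in> Linf G" for n
      using \<sigma> O_L by blast
    \<comment> \<open>The supremum need not be attained, but at least half of it is reached at some
      point; at distance 0 any point serves. The coset representatives then factor this
      point.\<close>
    have "\<exists>s\<in>T. \<exists>k\<in>K. ?d (\<sigma> m) (\<sigma> n) \<le> 2 * \<bar>\<sigma> m (k \<otimes> s) - \<sigma> n (k \<otimes> s)\<bar>" for m n
    proof -
      have "\<exists>x\<in>carrier G. ?d (\<sigma> m) (\<sigma> n) \<le> 2 * \<bar>\<sigma> m x - \<sigma> n x\<bar>"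
      proof (rule ccontr)
        assume contra: "\<not> ?thesis"
        then have "\<forall>x\<in>carrier G. \<bar>\<sigma> m x - \<sigma> n x\<bar> \<le> ?d (\<sigma> m) (\<sigma> n) / 2"
          by force
        then have "?d (\<sigma> m) (\<sigma> n) \<le> ?d (\<sigma> m) (\<sigma> n) / 2"
          by (simp only: mdist_Linf_le_iff[OF \<sigma>L \<sigma>L])
        then have "?d (\<sigma> m) (\<sigma> n) \<le> 0"
          by simp
        also have "0 \<le> 2 * \<bar>\<sigma> m \<one> - \<sigma> n \<one>\<bar>"
          by simp
        finally show False
          using contra one_closed by blast
      qed
      then show ?thesis
        using K(3) by metis
    qed
    then have "\<forall>p. \<exists>s. s \<in> T \<and> (\<exists>k\<in>K. ?d (\<sigma> (fst p)) (\<sigma> (snd p)) \<le> 2 * \<bar>\<sigma> (fst p) (k \<otimes> s) - \<sigma> (snd p) (k \<otimes> s)\<bar>)"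
      by blast
    from choice[OF this] obtain w where w: "\<And>p. w p \<in> T"
      "\<And>p. \<exists>k\<in>K. ?d (\<sigma> (fst p)) (\<sigma> (snd p)) \<le> 2 * \<bar>\<sigma> (fst p) (k \<otimes> w p) - \<sigma> (snd p) (k \<otimes> w p)\<bar>"
      by blast
    define A where "A = range t \<union> range w"
    define S where "S = generate G A"
    have A: "A \<subseteq> T" "countable A" "A \<subseteq> carrier G"
      using t(1) w(1) T_sub by (auto simp: A_def)
    have S: "subgroup S G" "countable S" "S \<subseteq> T"
      using A T by (simp_all add: S_def generate_is_subgroup countable_generate generate_subgroup_incl)
    have tS: "t n \<in> S" "w p \<in> S" for n p
      unfolding S_def A_def by (auto intro: generate.incl)
    have S_sub: "S \<subseteq> carrier G"
      using S(3) T_sub by blast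
    have "orbit_hull G S \<xi> \<subseteq> orbit_hull G T \<xi>"
      unfolding orbit_hull_def by (intro closure_of_mono image_mono S(3))
    then have hullS: "T_aa G S f" if "f \<in> orbit_hull G S \<xi>" for f
      using that hull T_aa_mono[OF _ S(3)] by blast
    obtain \<rho> :: "nat \<Rightarrow> nat" where \<rho>: "strict_mono \<rho>"
      "\<And>e. e > 0 \<Longrightarrow> \<exists>N. \<forall>m\<ge>N. \<forall>n\<ge>N. \<forall>k\<in>K. \<forall>s\<in>S. \<bar>\<xi> (k \<otimes> s \<otimes> t (\<rho> m)) - \<xi> (k \<otimes> s \<otimes> t (\<rho> n))\<bar> < e"
      by (rule countable_orbit_equicontinuous[of \<xi> S K t, OF \<xi> S(1,2) K(1,2) hullS tS(1)])
        (assumption, rule that)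
    have "\<exists>N. \<forall>m n. N \<le> m \<longrightarrow> N \<le> n \<longrightarrow> ?d ((\<sigma> \<circ> \<rho>) m) ((\<sigma> \<circ> \<rho>) n) < e" if "e > 0" for e
    proof -
      obtain N where N: "\<forall>m\<ge>N. \<forall>n\<ge>N. \<forall>k\<in>K. \<forall>s\<in>S. \<bar>\<xi> (k \<otimes> s \<otimes> t (\<rho> m)) - \<xi> (k \<otimes> s \<otimes> t (\<rho> n))\<bar> < e/2"
        using \<rho>(2)[of "e/2"] \<open>e > 0\<close> by auto
      have "?d (\<sigma> (\<rho> m)) (\<sigma> (\<rho> n)) < e" if "m \<ge> N" "n \<ge> N" for m n
      proof -
        define s where "s = w (\<rho> m, \<rho> n)"
        obtain k where k: "k \<in> K" "?d (\<sigma> (\<rho> m)) (\<sigma> (\<rho> n)) \<le> 2 * \<bar>\<sigma> (\<rho> m) (k \<otimes> s) - \<sigma> (\<rho> n) (k \<otimes> s)\<bar>"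
          using w(2)[of "(\<rho> m, \<rho> n)"] by (auto simp: s_def)
        have "k \<otimes> s \<in> carrier G"
          using k(1) K(2) subsetD[OF S_sub tS(2)] by (auto simp: s_def)
        then have "?d (\<sigma> (\<rho> m)) (\<sigma> (\<rho> n)) \<le> 2 * \<bar>\<xi> (k \<otimes> s \<otimes> t (\<rho> m)) - \<xi> (k \<otimes> s \<otimes> t (\<rho> n))\<bar>"
          using k(2) by (simp add: t(2))
        moreover have "\<bar>\<xi> (k \<otimes> s \<otimes> t (\<rho> m)) - \<xi> (k \<otimes> s \<otimes> t (\<rho> n))\<bar> < e/2"
          using N that k(1) tS(2) unfolding s_def by blast
        ultimately show ?thesis
          by simp
      qed
      then show ?thesis
        by auto
    qed
    then have "L.MCauchy (\<sigma> \<circ> \<rho>)"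
      using \<sigma>L unfolding L.MCauchy_def by auto
    with \<rho>(1) show ?thesis
      by blast
  qed
  then have "L.mtotally_bounded ?O"
    unfolding L.mtotally_bounded_sequentially using O_L by blast
  then show ?thesis
    using bochner_ap_iff_mtotally_bounded[OF \<xi> T_sub] by simp
qed

end

theorem theorem4p10:
  fixes G :: "('a, 'b) monoid_scheme" and T :: "'a set" and \<xi> :: "'a \<Rightarrow> real"
  assumes "group G"
    and "subgroup T G"
    and "syndetic G T"
    and "\<xi> \<in> Linf G"
  shows "bochner_ap G T \<xi> \<longleftrightarrow> (\<forall>f\<in>orbit_hull G T \<xi>. T_aa G T f)"
proof -
  interpret group G by (rule assms(1))
  show ?thesis
    using bochner_ap_imp_T_aa[OF assms(4,2)] T_aa_imp_bochner_ap[OF assms(4,2,3)] by blast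
qed

end
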